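(* Let $\tilde q_1,\dots,\tilde q_{r-1}$ be pairwise different integers such that each $|\tilde q_i|$ is an odd prime and $\tilde q_i\equiv1\pmod4$, and let $\tilde q_r=-4$. Let $\alpha_i=\frac{1+\sqrt{\tilde q_i}}2$ and $\tilde\alpha_i=\frac{1-\sqrt{\tilde q_i}}2$ for $1\le i\le r-1$, and let $\alpha_r=\sqrt{\frac{\tilde q_r}4}=\sqrt{-1}$. Then: 1. The set $\{\alpha_1^{s_1}\cdots\alpha_r^{s_r}:(s_1,\dots,s_r)\in\{0,1\}^r\}$ is a $\mathbb Z$-basis of the ring of integers of the field $\mathbb Q(\sqrt{\tilde q_1},\dots,\sqrt{\tilde q_r})$. 2. The set $\{\tilde\alpha_1^{s_1}\alpha_1^{1-s_1}\cdots\tilde\alpha_{r-1}^{s_{r-1}}\alpha_{r-1}^{1-s_{r-1}}\alpha_r^{s_r}:(s_1,\dots,s_r)\in\{0,1\}^r\}$ is a $\mathbb Z$-basis of the ring of integers of the field $\mathbb Q(\sqrt{\tilde q_1},\dots,\sqrt{\tilde q_r})$.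
   Context: For each $i$, $\sqrt{\tilde q_i}\in\mathbb C$ denotes a fixed square root of $\tilde q_i$. The sets are understood as families indexed by $\{0,1\}^r$. *)

theory Defs
  imports
    "HOL-Algebra.Algebraic_Closure_Type"
    "HOL-Algebra.Generated_Fields"
    "HOL-Number_Theory.Cong"
    Complex_Main
begin

global_interpretation int_complex: Modules.module "\<lambda>(n::int) (x::complex). of_int n * x"
  by unfold_locales (simp_all add: algebra_simps)

(* Family version of "basis": injectivity rules out repeated members, which
   independence of the image set alone would not detect. *)
definition int_basis_family :: "'i set \<Rightarrow> ('i \<Rightarrow> complex) \<Rightarrow> complex set \<Rightarrow> bool" where
  "int_basis_family I b M \<longleftrightarrow>
     inj_on b I \<and> int_complex.independent (b ` I) \<and> int_complex.span (b ` I) = M"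

(* As the smallest subfield of the complex numbers containing S, this automatically
   contains the rationals. *)
definition rat_adjoin :: "complex set \<Rightarrow> complex set" where
  "rat_adjoin S = generate_field (ring_of_type_algebra :: complex ring) S"

definition ring_of_integers :: "complex set \<Rightarrow> complex set" where
  "ring_of_integers K = {x \<in> K. algebraic_int x}"

end

theory Submission
  imports Defs "Jordan_Normal_Form.Char_Poly" "HOL-Number_Theory.Residues"
begin

text \<open>
  The field is built as a tower: first the square root of \<open>-4\<close> is adjoined to the rationals, then
  the square roots \<open>s\<close> of the integers \<open>q\<close> one at a time. The claim is that in each step
  the ring of integers grows from \<open>R\<close> to \<open>R \<oplus> R \<alpha>\<close>, where \<open>\<alpha>\<close> is \<open>s / 2\<close> in the first step and
  \<open>(1 + s) / 2\<close> afterwards. Multiplying the bases along the tower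
  (\<open>int_free_family_insert\<close>) gives the first family. For the second one the pair \<open>(1, \<alpha>)\<close> is
  replaced, in all steps but the first, by \<open>(\<alpha>, 1 - \<alpha>)\<close>, which spans the same module
  (\<open>free_rank_two_complement\<close>).

  The reason for the step (\<open>ring_of_integers_adjoin_sqrt_prime\<close>) is that the primes
  \<open>p = \<bar>q\<bar>\<close> are odd and distinct, so \<open>p\<close> is unramified in the field \<open>K\<close> reached before \<open>q\<close>. What is
  needed of this is only that the integers of \<open>K\<close> have no nilpotents modulo \<open>p\<close>. That follows
  without discriminants from the Frobenius map: the algebraic integers \<open>c\<close> with \<open>c ^ p\<^sup>2\<close> congruent
  to \<open>c\<close> modulo \<open>p\<close> form a ring (\<open>frobenius_fixed_add\<close>, \<open>frobenius_fixed_mult\<close>), Fermat's theorem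
  puts the generators of the integers of \<open>K\<close> into it (\<open>frobenius_fixed_sqrt\<close>,
  \<open>frobenius_fixed_half\<close>), and in such a ring \<open>p\<close> divides \<open>c\<close> whenever it divides \<open>c\<^sup>2\<close>
  (\<open>frobenius_fixed_reduced\<close>). If \<open>x\<close> is an integer of \<open>K(s)\<close>, the difference of \<open>x\<close> and its
  conjugate then determines its coordinate at \<open>\<alpha>\<close> and shows that it is integral. The same property
  yields that \<open>s\<close> is not in \<open>K\<close>, so the degree of the tower needs no separate argument.

  All of this takes place inside the ring of all complex algebraic integers; its closure under
  sums and products comes from the characteristic polynomials of integer matrices.
\<close>

section \<open>The ring of algebraic integers\<close>

text \<open>
  An eigenvalue of an integer matrix is a root of its characteristic polynomial, which is monic
  with integer coefficients. The vector \<open>v\<close> is the eigenvector.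
\<close>

lemma algebraic_int_of_int_matrix:
  fixes v :: "nat \<Rightarrow> complex" and M :: "nat \<Rightarrow> nat \<Rightarrow> int"
  assumes rows: "\<And>i. i < n \<Longrightarrow> x * v i = (\<Sum>j<n. of_int (M i j) * v j)"
    and nonzero: "k < n" "v k \<noteq> 0"
  shows "algebraic_int x"
proof -
  define B where "B = mat n n (\<lambda>(i, j). M i j)"
  define A where "A = map_mat complex_of_int B"
  have B: "B \<in> carrier_mat n n" and A: "A \<in> carrier_mat n n"
    by (auto simp: B_def A_def)
  have "eigenvector A (vec n v) x"
    unfolding eigenvector_def
  proof (intro conjI)
    show "vec n v \<in> carrier_vec (dim_row A)" using A by auto
    show "vec n v \<noteq> 0\<^sub>v (dim_row A)"
    proof
      assume "vec n v = 0\<^sub>v (dim_row A)"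
      from arg_cong[OF this, of "\<lambda>w. vec_index w k"] show False
        using nonzero A by auto
    qed
    show "A *\<^sub>v vec n v = x \<cdot>\<^sub>v vec n v"
      by (rule eq_vecI)
         (auto simp: A_def B_def scalar_prod_def rows atLeast0LessThan intro!: sum.cong)
  qed
  then have "poly (char_poly A) x = 0"
    using eigenvalue_root_char_poly[OF A] by (auto simp: eigenvalue_def)
  moreover have "char_poly A = map_poly of_int (char_poly B)"
    unfolding A_def by (rule of_int_hom.char_poly_hom[OF B])
  ultimately show ?thesis
    using degree_monic_char_poly[OF B] by (auto simp: algebraic_int_altdef_ipoly)
qed

text \<open>
  The module-theoretic criterion for integrality: writing each product \<open>x * g\<close> in the generators
  gives an integer matrix for which the tuple of generators is an eigenvector.
\<close>

lemma algebraic_int_of_stable_span: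
  fixes G :: "complex set"
  assumes "finite G" and "g \<in> G" "g \<noteq> 0"
    and stable: "\<And>g. g \<in> G \<Longrightarrow> x * g \<in> int_complex.span G"
  shows "algebraic_int x"
proof -
  obtain h where h: "bij_betw h {..<card G} G"
    using ex_bij_betw_nat_finite[OF assms(1)] by (auto simp: atLeast0LessThan)
  have "\<exists>c. x * h i = (\<Sum>j<card G. of_int (c j) * h j)" if "i < card G" for i
  proof -
    have "h i \<in> G" using h that by (auto simp: bij_betw_def)
    then obtain u where "x * h i = (\<Sum>w\<in>G. of_int (u w) * w)"
      using stable int_complex.span_finite[OF assms(1)] by blast
    also have "\<dots> = (\<Sum>j<card G. of_int (u (h j)) * h j)"
      by (rule sum.reindex_bij_betw[OF h, symmetric])
    finally show ?thesis by (intro exI[of _ "\<lambda>j. u (h j)"])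
  qed
  then have "\<forall>i. \<exists>c. i < card G \<longrightarrow> x * h i = (\<Sum>j<card G. of_int (c j) * h j)"
    by blast
  from choice[OF this] obtain M
    where M: "\<forall>i. i < card G \<longrightarrow> x * h i = (\<Sum>j<card G. of_int (M i j) * h j)" ..
  have "g \<in> h ` {..<card G}"
    using assms(2) unfolding bij_betw_imp_surj_on[OF h] .
  then obtain k where "k < card G" "h k = g" by auto
  with M show ?thesis
    using assms(3) by (intro algebraic_int_of_int_matrix[of "card G" x h M k]) auto
qed

text \<open>
  The monic equation of \<open>x\<close>, solved for its leading power. It lets every product with \<open>x\<close> be
  reduced to the powers below \<open>n\<close>.
\<close>

lemma algebraic_int_power_relation:
  assumes "algebraic_int (x :: complex)"
  obtains n c where "n > 0" "x ^ n = (\<Sum>i<n. of_int (c i) * x ^ i)"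
proof -
  obtain p where p: "poly (map_poly of_int p) x = 0" "lead_coeff p = 1"
    using assms by (auto simp: algebraic_int_altdef_ipoly)
  define n where "n = degree p"
  have "0 = (\<Sum>i\<le>n. of_int (coeff p i) * x ^ i)"
    using p(1) by (simp add: poly_altdef n_def coeff_map_poly degree_map_poly)
  also have "\<dots> = (\<Sum>i<n. of_int (coeff p i) * x ^ i) + x ^ n"
    using p(2) by (simp add: n_def flip: lessThan_Suc_atMost)
  finally have rel: "x ^ n = (\<Sum>i<n. of_int (- coeff p i) * x ^ i)"
    by (simp add: sum_negf eq_neg_iff_add_eq_0 add.commute)
  moreover have "n > 0"
    using rel by (cases "n = 0") auto
  ultimately show ?thesis by (rule that[rotated])
qed

lemma span_mult_mem:
  assumes "\<And>g. g \<in> G \<Longrightarrow> x * g \<in> int_complex.span G" and "w \<in> int_complex.span G"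
  shows "x * w \<in> int_complex.span G"
  using assms(2)
proof (induction rule: int_complex.span_induct_alt)
  case base
  then show ?case by (simp add: int_complex.span_zero)
next
  case (step c g y)
  have "x * (of_int c * g + y) = of_int c * (x * g) + x * y" by (simp add: algebra_simps)
  also have "\<dots> \<in> int_complex.span G"
    using step assms(1) by (intro int_complex.span_add int_complex.span_scale) auto
  finally show ?case .
qed

text \<open>
  The monomials \<open>x ^ i * y ^ j\<close> below the two degrees span a module that both \<open>x\<close> and \<open>y\<close> map to
  itself, so \<open>x + y\<close> and \<open>x * y\<close> do so as well. This is what makes the algebraic integers a ring.
\<close>

lemma common_stable_span:
  assumes "algebraic_int (x :: complex)" "algebraic_int y"
  obtains G where "finite G" "1 \<in> G"
    "\<And>w. w \<in> int_complex.span G \<Longrightarrow> x * w \<in> int_complex.span G"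
    "\<And>w. w \<in> int_complex.span G \<Longrightarrow> y * w \<in> int_complex.span G"
proof -
  obtain m a where m: "m > 0" "x ^ m = (\<Sum>i<m. of_int (a i) * x ^ i)"
    using algebraic_int_power_relation[OF assms(1)] .
  obtain n b where n: "n > 0" "y ^ n = (\<Sum>i<n. of_int (b i) * y ^ i)"
    using algebraic_int_power_relation[OF assms(2)] .
  define G where "G = (\<Union>i<m. \<Union>j<n. {x ^ i * y ^ j})"
  have G: "x ^ i * y ^ j \<in> int_complex.span G" if "i < m" "j < n" for i j
    using that by (intro int_complex.span_base) (auto simp: G_def)
  have x: "x * g \<in> int_complex.span G" if g: "g \<in> G" for g
  proof -
    obtain i j where ij: "g = x ^ i * y ^ j" "i < m" "j < n"
      using g unfolding G_def by blast
    show ?thesis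
    proof (cases "Suc i < m")
      case True
      then show ?thesis using G[of "Suc i" j] ij by (simp add: mult_ac)
    next
      case False
      then have "Suc i = m" using ij by simp
      then have "x * g = x ^ m * y ^ j" using ij by (auto simp: mult_ac)
      also have "\<dots> = (\<Sum>k<m. of_int (a k) * (x ^ k * y ^ j))"
        unfolding m(2) sum_distrib_right by (simp add: mult.assoc)
      also have "\<dots> \<in> int_complex.span G"
        using ij G by (intro int_complex.span_sum int_complex.span_scale) auto
      finally show ?thesis .
    qed
  qed
  have y: "y * g \<in> int_complex.span G" if g: "g \<in> G" for g
  proof -
    obtain i j where ij: "g = x ^ i * y ^ j" "i < m" "j < n"
      using g unfolding G_def by blast
    show ?thesis
    proof (cases "Suc j < n")
      case True
      then show ?thesis using G[of i "Suc j"] ij by (simp add: mult_ac)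
    next
      case False
      then have "Suc j = n" using ij by simp
      then have "y * g = x ^ i * y ^ n" using ij by (auto simp: mult_ac)
      also have "\<dots> = (\<Sum>k<n. of_int (b k) * (x ^ i * y ^ k))"
        unfolding n(2) sum_distrib_left by (simp add: mult.left_commute)
      also have "\<dots> \<in> int_complex.span G"
        using ij G by (intro int_complex.span_sum int_complex.span_scale) auto
      finally show ?thesis .
    qed
  qed
  show ?thesis
  proof (rule that)
    show "finite G" by (simp add: G_def)
    show "1 \<in> G" using m(1) n(1) by (force simp: G_def intro!: bexI[of _ 0])
    show "x * w \<in> int_complex.span G" if "w \<in> int_complex.span G" for w
      by (rule span_mult_mem[OF x that])
    show "y * w \<in> int_complex.span G" if "w \<in> int_complex.span G" for w
      by (rule span_mult_mem[OF y that])
  qed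
qed

lemma algebraic_int_add [intro]:
  assumes "algebraic_int (x :: complex)" "algebraic_int y"
  shows "algebraic_int (x + y)"
proof -
  obtain G where G: "finite G" "1 \<in> G"
    "\<And>w. w \<in> int_complex.span G \<Longrightarrow> x * w \<in> int_complex.span G"
    "\<And>w. w \<in> int_complex.span G \<Longrightarrow> y * w \<in> int_complex.span G"
    using common_stable_span[OF assms] by blast
  show ?thesis
  proof (rule algebraic_int_of_stable_span[OF G(1,2)])
    show "(x + y) * g \<in> int_complex.span G" if "g \<in> G" for g
      unfolding distrib_right
      by (intro int_complex.span_add G(3,4) int_complex.span_base that)
  qed simp
qed

lemma algebraic_int_mult [intro]:
  assumes "algebraic_int (x :: complex)" "algebraic_int y"
  shows "algebraic_int (x * y)"
proof -
  obtain G where G: "finite G" "1 \<in> G"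
    "\<And>w. w \<in> int_complex.span G \<Longrightarrow> x * w \<in> int_complex.span G"
    "\<And>w. w \<in> int_complex.span G \<Longrightarrow> y * w \<in> int_complex.span G"
    using common_stable_span[OF assms] by blast
  show ?thesis
  proof (rule algebraic_int_of_stable_span[OF G(1,2)])
    show "(x * y) * g \<in> int_complex.span G" if "g \<in> G" for g
      unfolding mult.assoc by (intro G(3,4) int_complex.span_base that)
  qed simp
qed

lemma algebraic_int_diff [intro]:
  "algebraic_int (x :: complex) \<Longrightarrow> algebraic_int y \<Longrightarrow> algebraic_int (x - y)"
  using algebraic_int_add[of x "- y"] by simp

lemma algebraic_int_power [intro]: "algebraic_int (x :: complex) \<Longrightarrow> algebraic_int (x ^ n)"
  by (induction n) auto

lemma algebraic_int_sum [intro]: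
  "(\<And>i. i \<in> I \<Longrightarrow> algebraic_int (f i :: complex)) \<Longrightarrow> algebraic_int (\<Sum>i\<in>I. f i)"
  by (induction I rule: infinite_finite_induct) auto

lemma algebraic_int_if_square_of_int:
  fixes s :: complex
  assumes "s\<^sup>2 = of_int m"
  shows "algebraic_int s"
  using algebraic_int_root[of "s\<^sup>2" "monom 1 2" s] assms
  by (simp add: poly_monom degree_monom_eq)

section \<open>Algebraic integers fixed by the second power of Frobenius\<close>

text \<open>
  Congruence modulo \<open>p\<close> in the ring of all complex algebraic integers. Between elements of a
  subfield it is automatically a congruence in the ring of integers of that subfield, so one
  relation serves for all stages of the tower.
\<close>

definition int_cong :: "nat \<Rightarrow> complex \<Rightarrow> complex \<Rightarrow> bool" where
  "int_cong p x y \<longleftrightarrow> algebraic_int ((x - y) / of_nat p)"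

lemma int_cong_refl [simp]: "int_cong p x x"
  by (simp add: int_cong_def)

lemma int_cong_trans [trans]: "int_cong p x y \<Longrightarrow> int_cong p y z \<Longrightarrow> int_cong p x z"
  unfolding int_cong_def using algebraic_int_add[of "(x - y) / of_nat p" "(y - z) / of_nat p"]
  by (simp add: diff_divide_distrib)

lemma int_cong_add:
  "int_cong p x y \<Longrightarrow> int_cong p x' y' \<Longrightarrow> int_cong p (x + x') (y + y')"
  unfolding int_cong_def using algebraic_int_add[of "(x - y) / of_nat p" "(x' - y') / of_nat p"]
  by (simp add: diff_divide_distrib add_divide_distrib algebra_simps)

lemma int_cong_mult:
  assumes "int_cong p x y" "int_cong p x' y'" "algebraic_int x" "algebraic_int y'"
  shows "int_cong p (x * x') (y * y')"
proof -
  have "(x * x' - y * y') / of_nat p = x * ((x' - y') / of_nat p) + (x - y) / of_nat p * y'"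
    by (cases "p = 0") (simp_all add: field_simps)
  moreover have "algebraic_int \<dots>"
    using assms unfolding int_cong_def by (intro algebraic_int_add algebraic_int_mult)
  ultimately show ?thesis unfolding int_cong_def by simp
qed

lemma int_cong_power:
  assumes "int_cong p x y" "algebraic_int x" "algebraic_int y"
  shows "int_cong p (x ^ n) (y ^ n)"
proof (induction n)
  case (Suc n)
  with assms show ?case
    unfolding power_Suc by (intro int_cong_mult algebraic_int_power)
qed simp

text \<open>
  The binomial coefficients strictly between the two ends are divisible by \<open>p\<close>.
\<close>

lemma int_cong_add_power_prime:
  assumes p: "Factorial_Ring.prime p" and x: "algebraic_int x" and y: "algebraic_int y"
  shows "int_cong p ((x + y) ^ p) (x ^ p + y ^ p)"
proof -
  have "p > 0" using p by (simp add: prime_gt_0_nat)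
  have "(x + y) ^ p = (\<Sum>k\<le>p. of_nat (p choose k) * x ^ k * y ^ (p - k))"
    by (rule binomial_ring)
  also have "{..p} = insert 0 (insert p {0<..<p})"
    using \<open>p > 0\<close> by auto
  also have "(\<Sum>k\<in>\<dots>. of_nat (p choose k) * x ^ k * y ^ (p - k))
      = y ^ p + (x ^ p + (\<Sum>k\<in>{0<..<p}. of_nat (p choose k) * x ^ k * y ^ (p - k)))"
    using \<open>p > 0\<close> by simp
  finally have "((x + y) ^ p - (x ^ p + y ^ p)) / of_nat p
      = (\<Sum>k\<in>{0<..<p}. of_nat (p choose k) * x ^ k * y ^ (p - k)) / of_nat p"
    by simp
  also have "\<dots> = (\<Sum>k\<in>{0<..<p}. of_nat ((p choose k) div p) * (x ^ k * y ^ (p - k)))"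
    unfolding sum_divide_distrib
  proof (rule sum.cong[OF refl])
    fix k assume "k \<in> {0<..<p}"
    then have "p dvd p choose k" using p by (intro dvd_choose_prime) auto
    then show "of_nat (p choose k) * x ^ k * y ^ (p - k) / of_nat p
        = of_nat ((p choose k) div p) * (x ^ k * y ^ (p - k))"
      using \<open>p > 0\<close> by (auto elim!: dvdE simp: field_simps)
  qed
  also have "algebraic_int \<dots>"
    using x y by (intro algebraic_int_sum algebraic_int_mult algebraic_int_power) simp_all
  finally show ?thesis unfolding int_cong_def .
qed

text \<open>
  The exponent is \<open>p\<^sup>2\<close> rather than \<open>p\<close> because, modulo an odd prime \<open>p\<close>,
  the Frobenius map sends a square root \<open>s\<close> of an
  integer prime to \<open>p\<close> to \<open>s\<close> or \<open>- s\<close>, according to a Legendre symbol; its second iterate fixes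
  \<open>s\<close> in both cases.
\<close>

definition frobenius_fixed :: "nat \<Rightarrow> complex \<Rightarrow> bool" where
  "frobenius_fixed p x \<longleftrightarrow> algebraic_int x \<and> int_cong p (x ^ p\<^sup>2) x"

lemma frobenius_fixed_add:
  assumes p: "Factorial_Ring.prime p" and "frobenius_fixed p x" "frobenius_fixed p y"
  shows "frobenius_fixed p (x + y)"
proof -
  have x: "algebraic_int x" "int_cong p (x ^ p\<^sup>2) x" and y: "algebraic_int y" "int_cong p (y ^ p\<^sup>2) y"
    using assms by (auto simp: frobenius_fixed_def)
  have "int_cong p (((x + y) ^ p) ^ p) ((x ^ p + y ^ p) ^ p)"
    using p x y by (intro int_cong_power int_cong_add_power_prime) auto
  also have "int_cong p ((x ^ p + y ^ p) ^ p) ((x ^ p) ^ p + (y ^ p) ^ p)"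
    using p x y by (intro int_cong_add_power_prime) auto
  also have "int_cong p ((x ^ p) ^ p + (y ^ p) ^ p) (x + y)"
    using x y by (intro int_cong_add) (simp_all add: power2_eq_square power_mult)
  finally show ?thesis
    using x y by (auto simp: frobenius_fixed_def power2_eq_square power_mult)
qed

lemma frobenius_fixed_mult:
  assumes "frobenius_fixed p x" "frobenius_fixed p y"
  shows "frobenius_fixed p (x * y)"
  using assms unfolding frobenius_fixed_def power_mult_distrib
  by (auto intro!: int_cong_mult)

lemma frobenius_fixed_0: "p > 0 \<Longrightarrow> frobenius_fixed p 0"
  by (simp add: frobenius_fixed_def power_0_left)

lemma frobenius_fixed_1: "frobenius_fixed p 1"
  by (simp add: frobenius_fixed_def)

lemma frobenius_fixed_of_nat:
  assumes "Factorial_Ring.prime p"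
  shows "frobenius_fixed p (of_nat n)"
  by (induction n)
     (use assms in \<open>auto intro: frobenius_fixed_0 frobenius_fixed_1 frobenius_fixed_add
        simp: prime_gt_0_nat\<close>)

lemma frobenius_fixed_of_int:
  assumes p: "Factorial_Ring.prime p" "odd p"
  shows "frobenius_fixed p (of_int m)"
proof -
  have "frobenius_fixed p (-1)"
    using p(2) by (simp add: frobenius_fixed_def)
  from frobenius_fixed_mult[OF this frobenius_fixed_of_nat[OF p(1)]]
  have "frobenius_fixed p (- of_nat n)" for n by simp
  then show ?thesis
    using frobenius_fixed_of_nat[OF p(1)] by (cases m rule: int_cases2) auto
qed

text \<open>
  The exponent \<open>p\<^sup>2 - 1\<close> is twice a multiple of \<open>p - 1\<close>, so \<open>s ^ (p\<^sup>2 - 1)\<close> is a power of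
  \<open>m ^ (p - 1)\<close>, and this is congruent to 1 by Fermat's theorem.
\<close>

lemma frobenius_fixed_sqrt:
  assumes p: "Factorial_Ring.prime p" "odd p" and s: "s\<^sup>2 = of_int m" and m: "\<not> int p dvd m"
  shows "frobenius_fixed p s"
proof -
  obtain k where k: "p = 2 * k + 1" using p(2) by (auto elim: oddE)
  have "[nat \<bar>m\<bar> ^ (p - 1) = 1] (mod p)"
    using m by (intro fermat_theorem p) (simp add: int_dvd_int_iff[symmetric])
  then have "[\<bar>m\<bar> ^ (p - 1) = 1] (mod int p)"
    by (simp add: cong_int_iff[symmetric])
  then have "[m ^ (2 * k) = 1] (mod int p)"
    by (simp add: k power_even_abs)
  then have "[(m ^ (2 * k)) ^ (k + 1) = 1 ^ (k + 1)] (mod int p)"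
    by (rule cong_pow)
  then have "int p dvd (m ^ (2 * k)) ^ (k + 1) - 1"
    by (simp add: cong_iff_dvd_diff)
  then obtain t where "(m ^ (2 * k)) ^ (k + 1) - 1 = int p * t" ..
  then have t: "(m ^ (2 * k)) ^ (k + 1) = 1 + int p * t" by simp
  have int: "algebraic_int s" using s by (rule algebraic_int_if_square_of_int)
  have "p\<^sup>2 = 2 * ((2 * k) * (k + 1)) + 1"
    by (simp add: k power2_eq_square algebra_simps)
  then have "s ^ p\<^sup>2 = (s\<^sup>2) ^ ((2 * k) * (k + 1)) * s"
    by (simp only: power_add power_mult power_one_right)
  also have "\<dots> = of_int ((m ^ (2 * k)) ^ (k + 1)) * s"
    by (simp only: s power_mult of_int_power)
  also have "\<dots> = s + of_nat p * (of_int t * s)"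
    unfolding t by (simp add: algebra_simps)
  finally show ?thesis
    using int p(1) by (auto simp: frobenius_fixed_def int_cong_def k)
qed

text \<open>
  The integer 2 is invertible modulo an odd prime, so halving preserves congruences between
  algebraic integers. This passes from \<open>1 + s\<close> to the generator \<open>(1 + s) / 2\<close>.
\<close>

lemma frobenius_fixed_half:
  assumes p: "Factorial_Ring.prime p" "odd p"
    and x: "algebraic_int x" and "frobenius_fixed p (2 * x)"
  shows "frobenius_fixed p x"
proof -
  obtain k where k: "p = 2 * k + 1" using p(2) by (auto elim: oddE)
  define N where "N = p\<^sup>2"
  have "p > 0" using p(1) by (simp add: prime_gt_0_nat)
  have two: "algebraic_int ((2 ^ N - 2) / of_nat p :: complex)"
    using frobenius_fixed_of_nat[OF p(1), of 2] by (simp add: frobenius_fixed_def int_cong_def N_def)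
  have twox: "algebraic_int ((2 ^ N * x ^ N - 2 * x) / of_nat p)"
    using assms(4) by (simp add: frobenius_fixed_def int_cong_def N_def power_mult_distrib)
  define d where "d = (x ^ N - x) / of_nat p"
  have "2 * d = (2 ^ N * x ^ N - 2 * x) / of_nat p - (2 ^ N - 2) / of_nat p * x ^ N"
    using \<open>p > 0\<close> by (simp add: d_def field_simps)
  moreover have "algebraic_int \<dots>"
    using two twox x by (intro algebraic_int_diff algebraic_int_mult algebraic_int_power)
  ultimately have two_d: "algebraic_int (2 * d)" by simp
  \<comment> \<open>Since 1 = p - 2 * k, integrality of p * d and of 2 * d implies integrality of d.\<close>
  have "d = of_nat p * d - of_nat k * (2 * d)"
    by (simp add: k algebra_simps)
  moreover have "of_nat p * d = x ^ N - x"
    using \<open>p > 0\<close> by (simp add: d_def)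
  moreover have "algebraic_int (x ^ N - x - of_nat k * (2 * d))"
    using x two_d by (intro algebraic_int_diff algebraic_int_mult[of "of_nat k"] algebraic_int_power)
      simp_all
  ultimately have "algebraic_int d" by metis
  then show ?thesis
    using x by (simp add: frobenius_fixed_def int_cong_def d_def N_def)
qed

text \<open>
  A ring on which some power of the Frobenius map is the identity modulo \<open>p\<close> has no nilpotent
  elements modulo \<open>p\<close>: if \<open>p\<close> divides \<open>c\<^sup>2\<close>, it divides \<open>c ^ p\<^sup>2\<close>, which is congruent to \<open>c\<close>.
  This takes the place of the usual discriminant argument that \<open>p\<close> is unramified.
\<close>

lemma frobenius_fixed_reduced:
  assumes p: "Factorial_Ring.prime p" and c: "frobenius_fixed p c"
    and sq: "algebraic_int (c\<^sup>2 / of_nat p)"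
  shows "algebraic_int (c / of_nat p)"
proof -
  have "p\<^sup>2 \<ge> 2"
    using prime_ge_2_nat[OF p] power_increasing[of 1 2 p] by simp
  then have "c ^ p\<^sup>2 = c\<^sup>2 * c ^ (p\<^sup>2 - 2)"
    using power_add[of c 2 "p\<^sup>2 - 2"] by (simp only: le_add_diff_inverse)
  then have "c / of_nat p = c\<^sup>2 / of_nat p * c ^ (p\<^sup>2 - 2) - (c ^ p\<^sup>2 - c) / of_nat p"
    by (simp add: diff_divide_distrib)
  moreover have "algebraic_int \<dots>"
    using c sq unfolding frobenius_fixed_def int_cong_def
    by (intro algebraic_int_diff algebraic_int_mult algebraic_int_power) auto
  ultimately show ?thesis by simp
qed

section \<open>Quadratic extensions and conjugation\<close>

text \<open>
  Subfields of the complex numbers in terms of the operations of the type itself, which spares the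
  record operations of \<open>ring_of_type_algebra\<close> in calculations.
\<close>

definition is_subfield :: "complex set \<Rightarrow> bool" where
  "is_subfield K \<longleftrightarrow> 1 \<in> K \<and> (\<forall>x\<in>K. \<forall>y\<in>K. x - y \<in> K \<and> x * y \<in> K) \<and> (\<forall>x\<in>K. inverse x \<in> K)"

lemma is_subfieldD:
  assumes K: "is_subfield K"
  shows is_subfield_0: "0 \<in> K" and is_subfield_1: "1 \<in> K"
    and is_subfield_diff: "\<And>x y. x \<in> K \<Longrightarrow> y \<in> K \<Longrightarrow> x - y \<in> K"
    and is_subfield_minus: "\<And>x. x \<in> K \<Longrightarrow> - x \<in> K"
    and is_subfield_add: "\<And>x y. x \<in> K \<Longrightarrow> y \<in> K \<Longrightarrow> x + y \<in> K"
    and is_subfield_mult: "\<And>x y. x \<in> K \<Longrightarrow> y \<in> K \<Longrightarrow> x * y \<in> K"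
    and is_subfield_inverse: "\<And>x. x \<in> K \<Longrightarrow> inverse x \<in> K"
    and is_subfield_divide: "\<And>x y. x \<in> K \<Longrightarrow> y \<in> K \<Longrightarrow> x / y \<in> K"
proof -
  show one: "1 \<in> K" and diff: "\<And>x y. x \<in> K \<Longrightarrow> y \<in> K \<Longrightarrow> x - y \<in> K"
    and mult: "\<And>x y. x \<in> K \<Longrightarrow> y \<in> K \<Longrightarrow> x * y \<in> K"
    and inverse: "\<And>x. x \<in> K \<Longrightarrow> inverse x \<in> K"
    using K by (auto simp: is_subfield_def)
  show zero: "0 \<in> K" using diff[OF one one] by simp
  show minus: "- x \<in> K" if "x \<in> K" for x using diff[OF zero that] by simp
  show "x + y \<in> K" if "x \<in> K" "y \<in> K" for x y using diff[OF that(1) minus[OF that(2)]] by simp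
  show "x / y \<in> K" if "x \<in> K" "y \<in> K" for x y
    unfolding divide_inverse by (intro mult inverse that)
qed

lemma is_subfield_of_int:
  assumes "is_subfield K"
  shows "of_int n \<in> K"
proof -
  have nat: "of_nat m \<in> K" for m
    by (induction m) (use is_subfieldD[OF assms] in auto)
  show ?thesis
    using nat is_subfield_minus[OF assms nat] by (cases n rule: int_cases2) auto
qed

lemma ring_of_type_algebra_ops:
  fixes x y :: complex
  shows "\<one>\<^bsub>ring_of_type_algebra\<^esub> = (1 :: complex)" "\<zero>\<^bsub>ring_of_type_algebra\<^esub> = (0 :: complex)"
    and "x \<oplus>\<^bsub>ring_of_type_algebra\<^esub> y = x + y" "x \<otimes>\<^bsub>ring_of_type_algebra\<^esub> y = x * y"
    and "\<ominus>\<^bsub>ring_of_type_algebra\<^esub> x = - x"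
    and "x \<noteq> 0 \<Longrightarrow> inv\<^bsub>ring_of_type_algebra\<^esub> x = inverse x"
proof -
  interpret field "ring_of_type_algebra :: complex ring"
    by (rule field_from_type_algebra)
  show "\<one>\<^bsub>ring_of_type_algebra\<^esub> = (1 :: complex)" "\<zero>\<^bsub>ring_of_type_algebra\<^esub> = (0 :: complex)"
    and "x \<oplus>\<^bsub>ring_of_type_algebra\<^esub> y = x + y" "x \<otimes>\<^bsub>ring_of_type_algebra\<^esub> y = x * y"
    by (simp_all add: ring_of_type_algebra_def)
  show "\<ominus>\<^bsub>ring_of_type_algebra\<^esub> x = - x"
    by (rule minus_equality) (simp_all add: ring_of_type_algebra_def)
  show "inv\<^bsub>ring_of_type_algebra\<^esub> x = inverse x" if "x \<noteq> 0"
    by (rule comm_inv_char) (use that in \<open>simp_all add: ring_of_type_algebra_def\<close>)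
qed

lemma rat_adjoin_subset: "S \<subseteq> rat_adjoin S"
  unfolding rat_adjoin_def by (auto intro: generate_field.incl)

lemma is_subfield_rat_adjoin: "is_subfield (rat_adjoin S)"
proof -
  let ?R = "ring_of_type_algebra :: complex ring"
  note gen = generate_field.one[of ?R S] generate_field.a_inv[of _ ?R S]
    generate_field.m_inv[of _ ?R S] generate_field.eng_add[of _ ?R S]
    generate_field.eng_mult[of _ ?R S]
  have minus: "- x \<in> rat_adjoin S" if "x \<in> rat_adjoin S" for x
    using gen(2) that by (simp add: rat_adjoin_def ring_of_type_algebra_ops)
  have add: "x + y \<in> rat_adjoin S" if "x \<in> rat_adjoin S" "y \<in> rat_adjoin S" for x y
    using gen(4) that by (simp add: rat_adjoin_def ring_of_type_algebra_ops)
  have mult: "x * y \<in> rat_adjoin S" if "x \<in> rat_adjoin S" "y \<in> rat_adjoin S" for x y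
    using gen(5) that by (simp add: rat_adjoin_def ring_of_type_algebra_ops)
  have inverse: "inverse x \<in> rat_adjoin S" if "x \<in> rat_adjoin S" for x
  proof (cases "x = 0")
    case False
    then show ?thesis using gen(3)[of x] that by (simp add: rat_adjoin_def ring_of_type_algebra_ops)
  qed (use that in simp)
  have one: "1 \<in> rat_adjoin S"
    using gen(1) by (simp add: rat_adjoin_def ring_of_type_algebra_ops)
  have "x - y \<in> rat_adjoin S" if "x \<in> rat_adjoin S" "y \<in> rat_adjoin S" for x y
    using add[OF that(1) minus[OF that(2)]] by simp
  then show ?thesis
    unfolding is_subfield_def using one mult inverse by blast
qed

lemma rat_adjoin_least:
  assumes "is_subfield K" "S \<subseteq> K"
  shows "rat_adjoin S \<subseteq> K"
proof
  fix x assume "x \<in> rat_adjoin S"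
  then show "x \<in> K"
    unfolding rat_adjoin_def
  proof induction
    case (m_inv h)
    then show ?case using is_subfieldD[OF assms(1)] by (simp add: ring_of_type_algebra_ops)
  qed (use assms is_subfieldD[OF assms(1)] in \<open>auto simp: ring_of_type_algebra_ops\<close>)
qed

definition quadratic_extension :: "complex set \<Rightarrow> complex \<Rightarrow> complex set" where
  "quadratic_extension K s = {a + b * s | a b. a \<in> K \<and> b \<in> K}"

text \<open>
  Inverses come from rationalising the denominator. The norm \<open>a\<^sup>2 - b\<^sup>2 * s\<^sup>2\<close> does not vanish because
  \<open>s\<close> lies outside \<open>K\<close>.
\<close>

lemma is_subfield_quadratic_extension:
  assumes K: "is_subfield K" and s: "s\<^sup>2 \<in> K" "s \<notin> K"
  shows "is_subfield (quadratic_extension K s)"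
proof -
  note K_simps = is_subfieldD[OF K]
  have mem: "a + b * s \<in> quadratic_extension K s" if "a \<in> K" "b \<in> K" for a b
    using that by (auto simp: quadratic_extension_def)
  show ?thesis
    unfolding is_subfield_def
  proof (intro conjI ballI)
    show "1 \<in> quadratic_extension K s"
      using mem[of 1 0] K_simps by simp
  next
    fix x y assume "x \<in> quadratic_extension K s" "y \<in> quadratic_extension K s"
    then obtain a b c d where ab: "a \<in> K" "b \<in> K" "x = a + b * s"
      and cd: "c \<in> K" "d \<in> K" "y = c + d * s"
      by (auto simp: quadratic_extension_def)
    have "x - y = (a - c) + (b - d) * s"
      by (simp add: ab cd algebra_simps)
    then show "x - y \<in> quadratic_extension K s"
      using mem[of "a - c" "b - d"] ab(1,2) cd(1,2) K_simps by metis
    have "x * y = (a * c + b * d * s\<^sup>2) + (a * d + b * c) * s"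
      by (simp add: ab cd algebra_simps power2_eq_square)
    then show "x * y \<in> quadratic_extension K s"
      using mem[of "a * c + b * d * s\<^sup>2" "a * d + b * c"] ab(1,2) cd(1,2) s K_simps by metis
  next
    fix x assume "x \<in> quadratic_extension K s"
    then obtain a b where ab: "a \<in> K" "b \<in> K" "x = a + b * s"
      by (auto simp: quadratic_extension_def)
    show "inverse x \<in> quadratic_extension K s"
    proof (cases "x = 0")
      case True
      then show ?thesis using mem[of 0 0] K_simps by simp
    next
      case False
      define N where "N = a\<^sup>2 - b\<^sup>2 * s\<^sup>2"
      have N: "N = x * (a - b * s)"
        by (simp add: N_def ab power2_eq_square algebra_simps)
      have "a - b * s \<noteq> 0"
      proof
        assume "a - b * s = 0"
        then have "a = b * s" by simp
        moreover from this False ab have "b \<noteq> 0" by auto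
        ultimately have "s = a / b" by simp
        then show False using s(2) ab K_simps by simp
      qed
      then have "inverse x = (a - b * s) / N"
        unfolding N by (simp add: divide_inverse)
      then have "inverse x = a / N + (- b / N) * s"
        by (simp add: diff_divide_distrib)
      moreover have "N \<in> K"
        unfolding N_def power2_eq_square[of a] power2_eq_square[of b] using ab s K_simps by simp
      ultimately show ?thesis
        using mem[of "a / N" "- b / N"] ab K_simps by simp
    qed
  qed
qed

lemma rat_adjoin_insert:
  assumes "s\<^sup>2 \<in> rat_adjoin S" "s \<notin> rat_adjoin S"
  shows "rat_adjoin (insert s S) = quadratic_extension (rat_adjoin S) s"
proof
  note K = is_subfieldD[OF is_subfield_rat_adjoin[of S]]
  have mem: "a + b * s \<in> quadratic_extension (rat_adjoin S) s"
    if "a \<in> rat_adjoin S" "b \<in> rat_adjoin S" for a b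
    using that by (auto simp: quadratic_extension_def)
  have "insert s S \<subseteq> quadratic_extension (rat_adjoin S) s"
  proof (intro insert_subsetI subsetI)
    show "s \<in> quadratic_extension (rat_adjoin S) s"
      using mem[of 0 1] K by simp
    show "x \<in> quadratic_extension (rat_adjoin S) s" if "x \<in> S" for x
      using mem[of x 0] K(1) that rat_adjoin_subset[of S] by auto
  qed
  then show "rat_adjoin (insert s S) \<subseteq> quadratic_extension (rat_adjoin S) s"
    by (intro rat_adjoin_least is_subfield_quadratic_extension is_subfield_rat_adjoin assms)
  have "rat_adjoin S \<subseteq> rat_adjoin (insert s S)"
    using rat_adjoin_subset[of "insert s S"]
    by (intro rat_adjoin_least is_subfield_rat_adjoin) auto
  then show "quadratic_extension (rat_adjoin S) s \<subseteq> rat_adjoin (insert s S)"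
    using rat_adjoin_subset[of "insert s S"]
    by (auto simp: quadratic_extension_def
        intro!: is_subfield_add is_subfield_mult is_subfield_rat_adjoin)
qed

text \<open>
  Polynomials over \<open>K\<close> commute with the conjugation that negates \<open>s\<close>. Treating the two values
  side by side avoids constructing conjugation as a map.
\<close>

lemma poly_quadratic_conjugate:
  assumes K: "is_subfield K" and s: "s\<^sup>2 \<in> K" and ab: "a \<in> K" "b \<in> K"
    and P: "\<And>i. coeff P i \<in> K"
  obtains A B where "A \<in> K" "B \<in> K" "poly P (a + b * s) = A + B * s" "poly P (a - b * s) = A - B * s"
proof -
  note K_simps = is_subfieldD[OF K]
  have "\<exists>A\<in>K. \<exists>B\<in>K. poly P (a + b * s) = A + B * s \<and> poly P (a - b * s) = A - B * s"
    using P
  proof (induction P)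
    case 0
    then show ?case using K_simps by (intro bexI[of _ 0]) simp_all
  next
    case (pCons c P)
    have "c \<in> K" using pCons.prems[of 0] by simp
    have "coeff P i \<in> K" for i using pCons.prems[of "Suc i"] by simp
    from pCons.IH[OF this] obtain A B where AB: "A \<in> K" "B \<in> K"
      "poly P (a + b * s) = A + B * s" "poly P (a - b * s) = A - B * s" by blast
    show ?case
    proof (intro bexI conjI)
      show "poly (pCons c P) (a + b * s) = (c + a * A + b * B * s\<^sup>2) + (a * B + b * A) * s"
        and "poly (pCons c P) (a - b * s) = (c + a * A + b * B * s\<^sup>2) - (a * B + b * A) * s"
        by (simp_all add: AB algebra_simps power2_eq_square)
    qed (use \<open>c \<in> K\<close> AB ab s K_simps in simp_all)
  qed
  then show thesis using that by blast
qed

text \<open>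
  Conjugate elements are roots of the same integer polynomial.
\<close>

lemma algebraic_int_quadratic_conjugate:
  assumes K: "is_subfield K" and s: "s\<^sup>2 \<in> K" "s \<notin> K" and ab: "a \<in> K" "b \<in> K"
    and int: "algebraic_int (a + b * s)"
  shows "algebraic_int (a - b * s)"
proof -
  obtain P where P: "lead_coeff P = 1" "\<forall>i. coeff P i \<in> \<int>" "poly P (a + b * s) = 0"
    using int by (auto elim: algebraic_int.cases)
  have "coeff P i \<in> K" for i
    using P(2) is_subfield_of_int[OF K] by (metis Ints_cases)
  then obtain A B where AB: "A \<in> K" "B \<in> K" "poly P (a + b * s) = A + B * s"
    "poly P (a - b * s) = A - B * s"
    using poly_quadratic_conjugate[OF K s(1) ab] by blast
  have "B = 0"
  proof (rule ccontr)
    assume "B \<noteq> 0"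
    then have "s = - A / B"
      using AB P(3) by (simp add: field_simps eq_neg_iff_add_eq_0)
    then show False using s(2) AB is_subfieldD[OF K] by simp
  qed
  then have "poly P (a - b * s) = 0" using AB P(3) by simp
  with P show ?thesis by (intro algebraic_int.intros)
qed

section \<open>Adjoining the square root of a prime\<close>

definition free_rank_two :: "complex set \<Rightarrow> complex \<Rightarrow> complex \<Rightarrow> complex set \<Rightarrow> bool" where
  "free_rank_two R u v N \<longleftrightarrow> N = {y * u + z * v | y z. y \<in> R \<and> z \<in> R}
     \<and> (\<forall>y\<in>R. \<forall>z\<in>R. y * u + z * v = 0 \<longrightarrow> y = 0 \<and> z = 0)"

lemma ring_of_integers_closed:
  assumes K: "is_subfield K" and "x \<in> ring_of_integers K" "y \<in> ring_of_integers K"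
  shows "x + y \<in> ring_of_integers K" "x - y \<in> ring_of_integers K"
  using assms is_subfieldD[OF K] by (auto simp: ring_of_integers_def)

text \<open>
  The pairs \<open>(1, \<alpha>)\<close> and \<open>(\<alpha>, 1 - \<alpha>)\<close> differ by a unimodular change of basis. Since
  \<open>1 - (1 + s) / 2 = (1 - s) / 2\<close>, this is the passage from the first family to the second.
\<close>

lemma free_rank_two_complement:
  assumes free: "free_rank_two R 1 \<alpha> N"
    and add: "\<And>x y. x \<in> R \<Longrightarrow> y \<in> R \<Longrightarrow> x + y \<in> R"
    and diff: "\<And>x y. x \<in> R \<Longrightarrow> y \<in> R \<Longrightarrow> x - y \<in> R"
  shows "free_rank_two R \<alpha> (1 - \<alpha>) N"
proof -
  have N: "N = {y * 1 + z * \<alpha> | y z. y \<in> R \<and> z \<in> R}"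
    and indep: "\<And>y z. y \<in> R \<Longrightarrow> z \<in> R \<Longrightarrow> y * 1 + z * \<alpha> = 0 \<Longrightarrow> y = 0 \<and> z = 0"
    using free unfolding free_rank_two_def by blast+
  have eq: "y * \<alpha> + z * (1 - \<alpha>) = z * 1 + (y - z) * \<alpha>" for y z
    by (simp add: algebra_simps)
  show ?thesis
    unfolding free_rank_two_def
  proof (intro conjI ballI impI)
    show "N = {y * \<alpha> + z * (1 - \<alpha>) | y z. y \<in> R \<and> z \<in> R}"
    proof (intro equalityI subsetI)
      fix x assume "x \<in> N"
      then obtain y z where yz: "x = y * 1 + z * \<alpha>" "y \<in> R" "z \<in> R"
        unfolding N by blast
      then have "x = (y + z) * \<alpha> + y * (1 - \<alpha>)" by (simp add: algebra_simps)
      then show "x \<in> {y * \<alpha> + z * (1 - \<alpha>) | y z. y \<in> R \<and> z \<in> R}"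
        using yz add by blast
    next
      fix x assume "x \<in> {y * \<alpha> + z * (1 - \<alpha>) | y z. y \<in> R \<and> z \<in> R}"
      then show "x \<in> N"
        unfolding N eq using diff by blast
    qed
  next
    fix y z assume "y \<in> R" "z \<in> R" "y * \<alpha> + z * (1 - \<alpha>) = 0"
    then have "z = 0 \<and> y - z = 0"
      unfolding eq by (intro indep diff)
    then show "y = 0" "z = 0" by auto
  qed
qed

text \<open>
  The step of the tower. Let \<open>x = y + z * \<alpha>\<close> be integral with \<open>y\<close> and \<open>z\<close> in \<open>K\<close> and
  \<open>\<alpha> = (1 + s) / 2\<close>. The difference of \<open>x\<close> and its conjugate is \<open>z * s\<close>, so \<open>z\<^sup>2 * q\<close> is integral.
  Then \<open>c = z * q\<close> is an integer of \<open>K\<close> and \<open>q\<close> divides \<open>c\<^sup>2\<close>. As the integers of \<open>K\<close> are reduced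
  modulo \<open>p\<close>, already \<open>q\<close> divides \<open>c\<close>, that is, \<open>z\<close> is integral, and therefore so is \<open>y\<close>.

  The same reducedness shows that \<open>s\<close> is not in \<open>K\<close>: otherwise \<open>q\<close> would divide \<open>s\<close>, so \<open>1 / q\<close>
  would be an algebraic integer.
\<close>

lemma ring_of_integers_adjoin_sqrt_prime:
  assumes K: "is_subfield K" and p: "Factorial_Ring.prime p"
    and q: "\<bar>q\<bar> = int p" "[q = 1] (mod 4)" and s: "s\<^sup>2 = of_int q"
    and frob: "\<And>c. c \<in> ring_of_integers K \<Longrightarrow> frobenius_fixed p c"
  shows "s \<notin> K"
    and "free_rank_two (ring_of_integers K) 1 ((1 + s) / 2)
           (ring_of_integers (quadratic_extension K s))"
proof -
  note K_simps = is_subfieldD[OF K]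
  have "p > 1" using p by (rule prime_gt_1_nat)
  have q_cases: "q = int p \<or> q = - int p" using q(1) by linarith
  then have q0: "complex_of_int q \<noteq> 0" using \<open>p > 1\<close> by auto
  have div_p: "algebraic_int (x / of_nat p) \<longleftrightarrow> algebraic_int (x / of_int q)" for x :: complex
    using q_cases by auto
  have s_int: "algebraic_int s" using s by (rule algebraic_int_if_square_of_int)
  have s2K: "s\<^sup>2 \<in> K" using is_subfield_of_int[OF K] s by simp
  have two: "2 \<in> K" using is_subfield_of_int[OF K, of 2] by simp
  have reduced: "algebraic_int (c / of_int q)"
    if "c \<in> K" "algebraic_int c" "algebraic_int (c\<^sup>2 / of_int q)" for c
    using frobenius_fixed_reduced[OF p, of c] frob[of c] that
    by (simp add: ring_of_integers_def div_p)
  show sK: "s \<notin> K"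
  proof
    assume "s \<in> K"
    then have "algebraic_int (s / of_int q)"
      using reduced[of s] s_int s q0 by simp
    then have "algebraic_int ((s / of_int q)\<^sup>2)" by (rule algebraic_int_power)
    also have "(s / of_int q)\<^sup>2 = 1 / of_int q"
      using s q0 by (simp add: power_divide power2_eq_square)
    finally have "1 / complex_of_int q \<in> \<int>"
      by (intro rational_algebraic_int_is_int) auto
    then obtain n where "1 / complex_of_int q = of_int n" by (auto elim: Ints_cases)
    then have "complex_of_int 1 = of_int (n * q)" using q0 by (simp add: field_simps)
    then have "n * q = 1" unfolding of_int_eq_iff by simp
    then have "\<bar>q\<bar> = 1" by (metis dvd_triv_right zdvd1_eq)
    then show False using q(1) \<open>p > 1\<close> by simp
  qed
  define \<alpha> where "\<alpha> = (1 + s) / 2"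
  have \<alpha>: "algebraic_int \<alpha>"
  proof -
    obtain t where t: "q - 1 = 4 * t"
      using q(2) by (auto simp: cong_iff_dvd_diff elim: dvdE)
    \<comment> \<open>The generator is a root of X^2 - X - (q - 1) / 4, which has integer coefficients because q is 1 modulo 4.\<close>
    have "poly [:0, -1, 1:] \<alpha> = of_int t"
    proof -
      have "4 * poly [:0, -1, 1:] \<alpha> = s\<^sup>2 - 1"
        by (simp add: \<alpha>_def field_simps power2_eq_square)
      also have "\<dots> = of_int (q - 1)" by (simp add: s)
      also have "\<dots> = 4 * of_int t" unfolding t by simp
      finally show ?thesis by simp
    qed
    then show ?thesis
      by (rule algebraic_int_root[rotated]) (auto simp: coeff_pCons split: nat.splits)
  qed
  have indep: "y = 0 \<and> z = 0" if yz: "y \<in> K" "z \<in> K" "y * 1 + z * \<alpha> = 0" for y z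
  proof -
    have "z = 0"
    proof (rule ccontr)
      assume "z \<noteq> 0"
      have "z * s + (2 * y + z) = 2 * (y * 1 + z * \<alpha>)" by (simp add: \<alpha>_def algebra_simps)
      then have "z * s + (2 * y + z) = 0" unfolding yz(3) by (simp only: mult_zero_right)
      then have "z * s = - (2 * y + z)" by (simp only: eq_neg_iff_add_eq_0)
      then have "s = - (2 * y + z) / z" using \<open>z \<noteq> 0\<close> by (simp add: field_simps)
      then show False using sK yz two K_simps by metis
    qed
    with yz(3) show ?thesis by simp
  qed
  have "ring_of_integers (quadratic_extension K s)
      = {y * 1 + z * \<alpha> | y z. y \<in> ring_of_integers K \<and> z \<in> ring_of_integers K}"
  proof (intro equalityI subsetI)
    fix x assume x: "x \<in> ring_of_integers (quadratic_extension K s)"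
    then obtain a b where ab: "a \<in> K" "b \<in> K" "x = a + b * s" and int: "algebraic_int x"
      by (auto simp: ring_of_integers_def quadratic_extension_def)
    define z where "z = 2 * b"
    have zK: "z \<in> K" using ab two K_simps by (simp add: z_def)
    have "algebraic_int (a - b * s)"
      using int algebraic_int_quadratic_conjugate[OF K s2K sK ab(1,2)] ab(3) by simp
    with int have "algebraic_int (x - (a - b * s))" by (rule algebraic_int_diff)
    then have zs: "algebraic_int (z * s)" by (simp add: ab z_def mult.assoc)
    have zq: "z * of_int q = z * s * s" by (simp add: mult.assoc flip: power2_eq_square s)
    have "algebraic_int (z * of_int q / of_int q)"
    proof (rule reduced)
      show "z * of_int q \<in> K" using zK is_subfield_of_int[OF K] K_simps by simp
      show "algebraic_int (z * of_int q)" unfolding zq using zs s_int by (rule algebraic_int_mult)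
      have "(z * of_int q)\<^sup>2 / of_int q = (z * s)\<^sup>2"
        unfolding power_mult_distrib s using q0 by (simp add: power2_eq_square)
      then show "algebraic_int ((z * of_int q)\<^sup>2 / of_int q)"
        using algebraic_int_power[OF zs] by simp
    qed
    then have z: "z \<in> ring_of_integers K" using zK q0 by (simp add: ring_of_integers_def)
    have y_eq: "a - b = x - z * \<alpha>" by (simp add: ab z_def \<alpha>_def field_simps)
    have "algebraic_int (a - b)"
      unfolding y_eq using int z \<alpha> by (auto simp: ring_of_integers_def)
    then have "a - b \<in> ring_of_integers K"
      using ab(1,2) K_simps by (simp add: ring_of_integers_def)
    moreover have "x = (a - b) * 1 + z * \<alpha>" using y_eq by simp
    ultimately show "x \<in> {y * 1 + z * \<alpha> | y z. y \<in> ring_of_integers K \<and> z \<in> ring_of_integers K}"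
      using z by blast
  next
    fix x assume "x \<in> {y * 1 + z * \<alpha> | y z. y \<in> ring_of_integers K \<and> z \<in> ring_of_integers K}"
    then obtain y z where yz: "y \<in> K" "algebraic_int y" "z \<in> K" "algebraic_int z"
      and x: "x = y + z * \<alpha>" by (auto simp: ring_of_integers_def)
    have "x = (y + z / 2) + (z / 2) * s" by (simp add: x \<alpha>_def distrib_left add_divide_distrib)
    moreover have "y + z / 2 \<in> K" "z / 2 \<in> K" using yz two K_simps by simp_all
    ultimately have "x \<in> quadratic_extension K s" unfolding quadratic_extension_def by blast
    then show "x \<in> ring_of_integers (quadratic_extension K s)"
      using yz \<alpha> by (auto simp: ring_of_integers_def x)
  qed
  then show "free_rank_two (ring_of_integers K) 1 ((1 + s) / 2)
      (ring_of_integers (quadratic_extension K s))"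
    unfolding free_rank_two_def \<alpha>_def[symmetric]
    using indep by (auto simp: ring_of_integers_def)
qed

text \<open>
  The congruence that makes integers reduced modulo \<open>p\<close> survives the adjunction of the square
  root of an integer prime to \<open>p\<close>, so it is still available when the turn of \<open>p\<close> comes.
\<close>

lemma frobenius_fixed_adjoin_sqrt_prime:
  assumes p: "Factorial_Ring.prime p" "odd p" and q: "\<not> int p dvd q" and s: "s\<^sup>2 = of_int q"
    and ext: "free_rank_two R 1 ((1 + s) / 2) N"
    and \<alpha>: "algebraic_int ((1 + s) / 2)"
    and R: "\<And>c. c \<in> R \<Longrightarrow> frobenius_fixed p c" and c: "c \<in> N"
  shows "frobenius_fixed p c"
proof -
  have "frobenius_fixed p (2 * ((1 + s) / 2))"
    using frobenius_fixed_add[OF p(1) frobenius_fixed_1 frobenius_fixed_sqrt[OF p s q]] by simp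
  then have "frobenius_fixed p ((1 + s) / 2)"
    using frobenius_fixed_half[OF p \<alpha>] by blast
  moreover obtain y z where yz: "y \<in> R" "z \<in> R" "c = y * 1 + z * ((1 + s) / 2)"
    using c ext unfolding free_rank_two_def by blast
  ultimately show ?thesis
    unfolding yz(3) using R p(1)
    by (intro frobenius_fixed_add frobenius_fixed_mult frobenius_fixed_1) simp_all
qed

section \<open>The Gaussian integers\<close>

lemma rat_adjoin_empty: "rat_adjoin {} = \<rat>"
proof
  have "is_subfield \<rat>" by (simp add: is_subfield_def)
  then show "rat_adjoin {} \<subseteq> \<rat>" by (rule rat_adjoin_least) simp
  have K: "is_subfield (rat_adjoin {})" by (rule is_subfield_rat_adjoin)
  show "\<rat> \<subseteq> rat_adjoin {}"
    by (auto elim!: Rats_cases' intro!: is_subfield_divide[OF K] is_subfield_of_int[OF K])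
qed

text \<open>
  The Gaussian integers, written with the square root \<open>s\<close> of \<open>-4\<close> instead of the imaginary unit
  \<open>s / 2\<close>. The sum, the difference and the product of an integral element
  \<open>m / 2 + (n / 2) * (s / 2)\<close> and its conjugate force \<open>m\<close>, \<open>n\<close> and
  \<open>(m\<^sup>2 + n\<^sup>2) / 4\<close> to be rational integers, and a sum of two squares is divisible by 4 only if both
  squares are even.
\<close>

lemma ring_of_integers_gaussian:
  assumes s: "s\<^sup>2 = -4"
  shows "s \<notin> rat_adjoin {}"
    and "free_rank_two \<int> 1 (s / 2) (ring_of_integers (quadratic_extension (rat_adjoin {}) s))"
proof -
  have "is_subfield (rat_adjoin {})" by (rule is_subfield_rat_adjoin)
  then have K: "is_subfield \<rat>" unfolding rat_adjoin_empty .
  define \<beta> where "\<beta> = s / 2"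
  have \<beta>2: "\<beta>\<^sup>2 = -1" by (simp add: \<beta>_def power_divide s)
  have not_real: "\<beta> \<notin> \<real>"
  proof
    assume "\<beta> \<in> \<real>"
    then obtain t where "\<beta> = of_real t" by (auto elim: Reals_cases)
    with \<beta>2 have "complex_of_real (t\<^sup>2) = of_real (-1)" by simp
    then have "t\<^sup>2 = -1" unfolding of_real_eq_iff .
    then show False by (metis neg_0_le_iff_le not_one_le_zero zero_le_power2)
  qed
  have Rats_Reals: "x \<in> \<real>" if "x \<in> \<rat>" for x :: complex
    using that by (auto elim!: Rats_cases')
  have sQ: "s \<notin> \<rat>"
  proof
    assume "s \<in> \<rat>"
    then have "s \<in> \<real>" by (rule Rats_Reals)
    then have "\<beta> \<in> \<real>" by (simp add: \<beta>_def)
    with not_real show False by simp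
  qed
  then show "s \<notin> rat_adjoin {}" by (simp add: rat_adjoin_empty)
  have \<beta>_int: "algebraic_int \<beta>"
    using algebraic_int_if_square_of_int[of \<beta> "-1"] \<beta>2 by simp
  have Ints_real: "x \<in> \<real>" if "x \<in> \<int>" for x :: complex
    using that by (auto elim!: Ints_cases)
  have indep: "y = 0 \<and> z = 0" if "y \<in> \<int>" "z \<in> \<int>" "y * 1 + z * \<beta> = 0" for y z
  proof -
    have "z = 0"
    proof (rule ccontr)
      assume "z \<noteq> 0"
      then have "\<beta> = - y / z" using that(3) by (simp add: field_simps eq_neg_iff_add_eq_0)
      then show False using not_real that Ints_real by (metis Reals_divide Reals_minus)
    qed
    then show ?thesis using that(3) by simp
  qed
  have "ring_of_integers (quadratic_extension \<rat> s) = {y * 1 + z * \<beta> | y z. y \<in> \<int> \<and> z \<in> \<int>}"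
  proof (intro equalityI subsetI)
    fix x assume "x \<in> ring_of_integers (quadratic_extension \<rat> s)"
    then obtain a b where ab: "a \<in> \<rat>" "b \<in> \<rat>" "x = a + b * s" and int: "algebraic_int x"
      by (auto simp: ring_of_integers_def quadratic_extension_def)
    have conj: "algebraic_int (a - b * s)"
      using algebraic_int_quadratic_conjugate[OF K _ sQ ab(1,2)] int ab(3) s by simp
    have "algebraic_int (x + (a - b * s))"
      using int conj by (rule algebraic_int_add)
    then have "2 * a \<in> \<int>"
      using ab by (intro rational_algebraic_int_is_int) auto
    then obtain m where m: "2 * a = of_int m" by (auto elim: Ints_cases)
    have "algebraic_int ((x - (a - b * s)) * \<beta>)"
      by (rule algebraic_int_mult[OF algebraic_int_diff[OF int conj] \<beta>_int])
    also have "(x - (a - b * s)) * \<beta> = 4 * b * \<beta>\<^sup>2"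
      by (simp add: ab \<beta>_def power2_eq_square)
    finally have "algebraic_int (4 * b)" by (simp add: \<beta>2)
    then have "4 * b \<in> \<int>"
      using ab by (intro rational_algebraic_int_is_int) auto
    then obtain n where n: "4 * b = of_int n" by (auto elim: Ints_cases)
    have "algebraic_int (x * (a - b * s))"
      using int conj by (rule algebraic_int_mult)
    also have "x * (a - b * s) = a\<^sup>2 - b\<^sup>2 * s\<^sup>2"
      by (simp add: ab power2_eq_square algebra_simps)
    also have "\<dots> = a\<^sup>2 + 4 * b\<^sup>2" by (simp add: s)
    finally have "a\<^sup>2 + 4 * b\<^sup>2 \<in> \<int>"
      using ab by (intro rational_algebraic_int_is_int) auto
    then obtain t where t: "a\<^sup>2 + 4 * b\<^sup>2 = of_int t" by (auto elim: Ints_cases)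
    have "complex_of_int (m\<^sup>2 + n\<^sup>2) = (2 * a)\<^sup>2 + (4 * b)\<^sup>2"
      by (simp add: m n)
    also have "\<dots> = 4 * (a\<^sup>2 + 4 * b\<^sup>2)" by (simp add: power2_eq_square)
    also have "\<dots> = of_int (4 * t)" by (simp add: t)
    finally have mn: "m\<^sup>2 + n\<^sup>2 = 4 * t" unfolding of_int_eq_iff .
    have "even m \<and> even n"
    proof -
      have sq: "k\<^sup>2 mod 4 = (if even k then 0 else 1)" for k :: int
      proof (cases "even k")
        case True
        then obtain l where "k = 2 * l" ..
        then show ?thesis by (simp add: power2_eq_square)
      next
        case False
        then obtain l where "k = 2 * l + 1" by (rule oddE)
        then have "k\<^sup>2 = 4 * (l\<^sup>2 + l) + 1" by (simp add: power2_eq_square algebra_simps)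
        then show ?thesis using False by presburger
      qed
      have "(m\<^sup>2 mod 4 + n\<^sup>2 mod 4) mod 4 = 0"
        using mn by (simp add: mod_add_eq)
      then show ?thesis unfolding sq by (auto split: if_splits)
    qed
    then obtain m' n' where "m = 2 * m'" "n = 2 * n'" by (auto elim!: evenE)
    then have "a = of_int m'" "2 * b = of_int n'"
      using m n by simp_all
    then have "x = of_int m' * 1 + of_int n' * \<beta>"
      by (simp add: ab \<beta>_def flip: \<open>2 * b = of_int n'\<close>)
    then show "x \<in> {y * 1 + z * \<beta> | y z. y \<in> \<int> \<and> z \<in> \<int>}"
      using Ints_of_int by blast
  next
    fix x assume "x \<in> {y * 1 + z * \<beta> | y z. y \<in> \<int> \<and> z \<in> \<int>}"
    then obtain m n where x: "x = of_int m + of_int n * \<beta>" by (auto elim!: Ints_cases)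
    have "x = of_int m + (of_int n / 2) * s" by (simp add: x \<beta>_def)
    moreover have "of_int m \<in> \<rat>" "of_int n / 2 \<in> (\<rat> :: complex set)" by simp_all
    ultimately have "x \<in> quadratic_extension \<rat> s" unfolding quadratic_extension_def by blast
    then show "x \<in> ring_of_integers (quadratic_extension \<rat> s)"
      using \<beta>_int by (auto simp: ring_of_integers_def x)
  qed
  then show "free_rank_two \<int> 1 (s / 2) (ring_of_integers (quadratic_extension (rat_adjoin {}) s))"
    unfolding free_rank_two_def \<beta>_def[symmetric] rat_adjoin_empty using indep by blast
qed

section \<open>Integral bases of products\<close>

text \<open>
  Basis families over the integers in terms of coefficients. Unlike \<open>int_basis_family\<close>, which
  speaks of the set of members, this form is convenient for induction on the index set.
\<close>

definition int_free_family :: "'i set \<Rightarrow> ('i \<Rightarrow> complex) \<Rightarrow> complex set \<Rightarrow> bool" where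
  "int_free_family I b M \<longleftrightarrow> M = {\<Sum>s\<in>I. of_int (c s) * b s | c :: 'i \<Rightarrow> int. True}
     \<and> (\<forall>c :: 'i \<Rightarrow> int. (\<Sum>s\<in>I. of_int (c s) * b s) = 0 \<longrightarrow> (\<forall>s\<in>I. c s = 0))"

lemma int_basis_family_if_free:
  assumes I: "finite I" and free: "int_free_family I b M"
  shows "int_basis_family I b M"
proof -
  have M: "M = {\<Sum>s\<in>I. of_int (c s) * b s | c. True}"
    and indep: "\<And>c s. (\<Sum>s\<in>I. of_int (c s) * b s) = 0 \<Longrightarrow> s \<in> I \<Longrightarrow> c s = 0"
    using free unfolding int_free_family_def by blast+
  have inj: "inj_on b I"
  proof (rule inj_onI, rule ccontr)
    fix s t assume st: "s \<in> I" "t \<in> I" "b s = b t" "s \<noteq> t"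
    \<comment> \<open>A repeated member would give the nontrivial relation b s - b t = 0.\<close>
    define c where "c x = (if x = s then 1 else 0) - (if x = t then 1 else 0 :: int)" for x
    have "(\<Sum>x\<in>I. of_int (c x) * b x)
        = (\<Sum>x\<in>I. (if x = s then b x else 0) - (if x = t then b x else 0))"
      by (rule sum.cong) (auto simp: c_def)
    also have "\<dots> = b s - b t"
      using st I by (simp add: sum_subtractf)
    finally have "c s = 0"
      using st by (intro indep[of c s]) simp_all
    then show False using st by (simp add: c_def)
  qed
  have "int_complex.independent (b ` I)"
    unfolding int_complex.independent_explicit_module
  proof (intro allI impI)
    fix t u v assume t: "finite t" "t \<subseteq> b ` I" "(\<Sum>v\<in>t. of_int (u v) * v) = 0" "v \<in> t"
    obtain s where s: "s \<in> I" "v = b s" using t by blast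
    define c where "c x = (if b x \<in> t then u (b x) else 0)" for x
    have "(\<Sum>x\<in>I. of_int (c x) * b x)
        = (\<Sum>w\<in>b ` I. of_int (if w \<in> t then u w else 0) * w)"
      by (simp add: sum.reindex[OF inj] c_def)
    also have "\<dots> = (\<Sum>w\<in>t. of_int (if w \<in> t then u w else 0) * w)"
      using I t by (intro sum.mono_neutral_right) auto
    also have "\<dots> = (\<Sum>w\<in>t. of_int (u w) * w)" by (rule sum.cong) auto
    finally have "c s = 0" using t(3) s by (intro indep[of c s]) simp_all
    then show "u v = 0" using s t by (simp add: c_def)
  qed
  moreover have "int_complex.span (b ` I) = M"
  proof -
    have "int_complex.span (b ` I) = range (\<lambda>u. \<Sum>s\<in>I. of_int (u (b s)) * b s)"
      using I by (simp add: int_complex.span_finite sum.reindex[OF inj])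
    also have "\<dots> = M"
    proof (intro equalityI subsetI)
      fix x assume "x \<in> M"
      then obtain c where x: "x = (\<Sum>s\<in>I. of_int (c s) * b s)" unfolding M by blast
      define u where "u w = c (the_inv_into I b w)" for w
      have "x = (\<Sum>s\<in>I. of_int (u (b s)) * b s)"
        unfolding x by (rule sum.cong) (auto simp: u_def the_inv_into_f_f[OF inj])
      then show "x \<in> range (\<lambda>u. \<Sum>s\<in>I. of_int (u (b s)) * b s)" by blast
    qed (auto simp: M)
    finally show ?thesis .
  qed
  ultimately show ?thesis
    unfolding int_basis_family_def using inj by blast
qed

lemma sum_PiE_insert_01:
  assumes "j \<notin> A"
  shows "(\<Sum>s\<in>insert j A \<rightarrow>\<^sub>E {0, 1::nat}. f s)
    = (\<Sum>g\<in>A \<rightarrow>\<^sub>E {0, 1}. f (g(j := 0))) + (\<Sum>g\<in>A \<rightarrow>\<^sub>E {0, 1}. f (g(j := 1)))"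
  (is "_ = ?rhs")
proof -
  have "(\<Sum>s\<in>insert j A \<rightarrow>\<^sub>E {0, 1::nat}. f s)
      = (\<Sum>(e, g)\<in>{0, 1} \<times> (A \<rightarrow>\<^sub>E {0, 1}). f (g(j := e)))"
    unfolding PiE_insert_eq using inj_combinator[OF assms, of "\<lambda>_. {0, 1}"]
    by (subst sum.reindex) (simp_all add: case_prod_unfold del: One_nat_def)
  also have "\<dots> = ?rhs"
    by (simp flip: sum.cartesian_product)
  finally show ?thesis .
qed

text \<open>
  Bases multiply along a tower: a basis of \<open>R\<close> over the integers and a basis of \<open>N\<close> over \<open>R\<close> give
  the basis of products of \<open>N\<close>. The exponent at the new index \<open>j\<close> selects the member of the pair.
\<close>

lemma int_free_family_insert:
  fixes w :: "nat \<Rightarrow> nat \<Rightarrow> complex"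
  assumes A: "finite A" "j \<notin> A"
    and free: "int_free_family (A \<rightarrow>\<^sub>E {0, 1}) (\<lambda>s. \<Prod>i\<in>A. w i (s i)) R"
    and ext: "free_rank_two R (w j 0) (w j 1) N"
  shows "int_free_family (insert j A \<rightarrow>\<^sub>E {0, 1}) (\<lambda>s. \<Prod>i\<in>insert j A. w i (s i)) N"
proof -
  define E where "E = (\<lambda>c :: (nat \<Rightarrow> nat) \<Rightarrow> int.
    \<Sum>s\<in>A \<rightarrow>\<^sub>E {0, 1}. of_int (c s) * (\<Prod>i\<in>A. w i (s i)))"
  have R: "R = range E"
    using free unfolding int_free_family_def E_def by auto
  have indep: "c g = 0" if "E c = 0" "g \<in> A \<rightarrow>\<^sub>E {0, 1}" for c g
    using free that unfolding int_free_family_def E_def by blast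
  have N: "N = {y * w j 0 + z * w j 1 | y z. y \<in> R \<and> z \<in> R}"
    and indep2: "\<And>y z. y \<in> R \<Longrightarrow> z \<in> R \<Longrightarrow> y * w j 0 + z * w j 1 = 0 \<Longrightarrow> y = 0 \<and> z = 0"
    using ext unfolding free_rank_two_def by blast+
  have prod: "(\<Prod>i\<in>insert j A. w i ((g(j := e)) i)) = (\<Prod>i\<in>A. w i (g i)) * w j e" for g e
  proof -
    have "(\<Prod>i\<in>A. w i ((g(j := e)) i)) = (\<Prod>i\<in>A. w i (g i))"
      using A by (intro prod.cong) auto
    then show ?thesis using A by (simp add: mult.commute)
  qed
  have split: "(\<Sum>s\<in>insert j A \<rightarrow>\<^sub>E {0, 1}. of_int (c s) * (\<Prod>i\<in>insert j A. w i (s i)))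
      = E (\<lambda>g. c (g(j := 0))) * w j 0 + E (\<lambda>g. c (g(j := 1))) * w j 1" for c
    unfolding sum_PiE_insert_01[OF A(2)] prod E_def sum_distrib_right by (simp add: mult.assoc)
  \<comment> \<open>Two coefficient functions for A combine into one for the enlarged index set. Resetting the value at j
    to undefined recovers the function on A, because functions in PiE are undefined outside A.\<close>
  have glue: "\<exists>c. E (\<lambda>g. c (g(j := 0))) = E c0 \<and> E (\<lambda>g. c (g(j := 1))) = E c1" for c0 c1
  proof -
    define c where "c s = (if s j = 0 then c0 else c1) (s(j := undefined))" for s
    have "g(j := undefined) = g" if "g \<in> A \<rightarrow>\<^sub>E {0, 1}" for g :: "nat \<Rightarrow> nat"
      using PiE_arb[OF that A(2)] by (metis fun_upd_triv)
    then have "E (\<lambda>g. c (g(j := 0))) = E c0" "E (\<lambda>g. c (g(j := 1))) = E c1"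
      unfolding E_def c_def by (auto intro!: sum.cong)
    then show ?thesis by blast
  qed
  show ?thesis
    unfolding int_free_family_def split
  proof (intro conjI allI impI ballI)
    show "N = {E (\<lambda>g. c (g(j := 0))) * w j 0 + E (\<lambda>g. c (g(j := 1))) * w j 1 | c. True}"
    proof (intro equalityI subsetI)
      fix x assume "x \<in> N"
      then obtain c0 c1 where "x = E c0 * w j 0 + E c1 * w j 1"
        unfolding N R by blast
      moreover obtain c where "E (\<lambda>g. c (g(j := 0))) = E c0" "E (\<lambda>g. c (g(j := 1))) = E c1"
        using glue by blast
      ultimately have "x = E (\<lambda>g. c (g(j := 0))) * w j 0 + E (\<lambda>g. c (g(j := 1))) * w j 1"
        by (simp only:)
      then show "x \<in> {E (\<lambda>g. c (g(j := 0))) * w j 0 + E (\<lambda>g. c (g(j := 1))) * w j 1 | c. True}"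
        by blast
    qed (auto simp: N R)
  next
    fix c :: "(nat \<Rightarrow> nat) \<Rightarrow> int" and s :: "nat \<Rightarrow> nat"
    assume zero: "E (\<lambda>g. c (g(j := 0))) * w j 0 + E (\<lambda>g. c (g(j := 1))) * w j 1 = 0"
      and s: "s \<in> insert j A \<rightarrow>\<^sub>E {0, 1}"
    have E0: "E (\<lambda>g. c (g(j := 0))) = 0" "E (\<lambda>g. c (g(j := 1))) = 0"
      using indep2[OF _ _ zero] by (auto simp: R)
    obtain e g where "e \<in> {0, 1}" "g \<in> A \<rightarrow>\<^sub>E {0, 1}" "s = g(j := e)"
      using s unfolding PiE_insert_eq by auto
    then show "c s = 0" using indep[OF E0(1)] indep[OF E0(2)] by auto
  qed
qed

section \<open>The multiquadratic field\<close>

theorem theorem8: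
  fixes r :: nat
    and q :: "nat \<Rightarrow> int"
    and sqrt_q \<alpha> \<alpha>' :: "nat \<Rightarrow> complex"
  assumes "r \<ge> 1"
    and "inj_on q {1..<r}"
    and "\<And>i. i \<in> {1..<r} \<Longrightarrow> Factorial_Ring.prime \<bar>q i\<bar> \<and> odd \<bar>q i\<bar> \<and> [q i = 1] (mod 4)"
    and "q r = - 4"
    and "\<And>i. i \<in> {1..r} \<Longrightarrow> (sqrt_q i)\<^sup>2 = of_int (q i)"
    and "\<And>i. i \<in> {1..<r} \<Longrightarrow> \<alpha> i = (1 + sqrt_q i) / 2"
    and "\<And>i. i \<in> {1..<r} \<Longrightarrow> \<alpha>' i = (1 - sqrt_q i) / 2"
    and "\<alpha> r = sqrt_q r / 2"
  shows "int_basis_family ({1..r} \<rightarrow>\<^sub>E {0, 1::nat})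
           (\<lambda>s. \<Prod>i\<in>{1..r}. \<alpha> i ^ s i)
           (ring_of_integers (rat_adjoin (sqrt_q ` {1..r})))
       \<and> int_basis_family ({1..r} \<rightarrow>\<^sub>E {0, 1::nat})
           (\<lambda>s. (\<Prod>i\<in>{1..<r}. \<alpha>' i ^ s i * \<alpha> i ^ (1 - s i)) * \<alpha> r ^ s r)
           (ring_of_integers (rat_adjoin (sqrt_q ` {1..r})))"
proof -
  \<comment> \<open>The index r is always present: the tower starts from the Gaussian field.\<close>
  define K where "K F = rat_adjoin (sqrt_q ` insert r F)" for F
  define w1 where "w1 i e = \<alpha> i ^ e" for i e :: nat
  define w2 where "w2 i e = (if i = r then \<alpha> r ^ e else \<alpha>' i ^ e * \<alpha> i ^ (1 - e))" for i e :: nat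
  have s_r: "(sqrt_q r)\<^sup>2 = -4" using assms(1,4,5) by simp
  \<comment> \<open>Distinct q i have distinct absolute values, since q and - q cannot both be 1 modulo 4.\<close>
  have abs_inj: "i = j" if "i \<in> {1..<r}" "j \<in> {1..<r}" "\<bar>q i\<bar> = \<bar>q j\<bar>" for i j
  proof -
    have "q i mod 4 = 1" "q j mod 4 = 1"
      using assms(3)[OF that(1)] assms(3)[OF that(2)] by (auto simp: cong_def)
    then have "q i \<noteq> - q j" by presburger
    then have "q i = q j" using that(3) by linarith
    then show ?thesis using assms(2) that by (auto dest: inj_onD)
  qed
  \<comment> \<open>The third conjunct makes every prime still to be adjoined unramified; it covers all odd primes
    outside F because the order of adjunction is left open.\<close>
  have tower: "int_free_family (insert r F \<rightarrow>\<^sub>E {0, 1}) (\<lambda>s. \<Prod>i\<in>insert r F. w1 i (s i))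
        (ring_of_integers (K F))
      \<and> int_free_family (insert r F \<rightarrow>\<^sub>E {0, 1}) (\<lambda>s. \<Prod>i\<in>insert r F. w2 i (s i))
        (ring_of_integers (K F))
      \<and> (\<forall>p c. Factorial_Ring.prime p \<and> odd p \<and> (\<forall>i\<in>F. \<bar>q i\<bar> \<noteq> int p)
           \<and> c \<in> ring_of_integers (K F) \<longrightarrow> frobenius_fixed p c)"
    if "finite F" "F \<subseteq> {1..<r}" for F
    using that
  proof (induction F)
    case empty
    note gauss = ring_of_integers_gaussian[OF s_r]
    have KF: "K {} = quadratic_extension (rat_adjoin {}) (sqrt_q r)"
      unfolding K_def using rat_adjoin_insert[OF _ gauss(1)] is_subfield_of_int[OF is_subfield_rat_adjoin, of "-4" "{}"]
      by (simp add: s_r)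
    have trivial: "int_free_family ({} \<rightarrow>\<^sub>E {0, 1}) (\<lambda>s. \<Prod>i\<in>{}. w i (s i)) \<int>"
      for w :: "nat \<Rightarrow> nat \<Rightarrow> complex"
      by (auto simp: int_free_family_def Ints_def)
    have ext: "free_rank_two \<int> 1 (\<alpha> r) (ring_of_integers (K {}))"
      using gauss(2) unfolding KF assms(8) .
    have "int_free_family (insert r {} \<rightarrow>\<^sub>E {0, 1}) (\<lambda>s. \<Prod>i\<in>insert r {}. w1 i (s i))
        (ring_of_integers (K {}))"
      using ext by (intro int_free_family_insert[OF _ _ trivial]) (simp_all add: w1_def)
    moreover have "int_free_family (insert r {} \<rightarrow>\<^sub>E {0, 1}) (\<lambda>s. \<Prod>i\<in>insert r {}. w2 i (s i))
        (ring_of_integers (K {}))"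
      using ext by (intro int_free_family_insert[OF _ _ trivial]) (simp_all add: w2_def)
    moreover have "frobenius_fixed p c"
      if p: "Factorial_Ring.prime p" "odd p" and c: "c \<in> ring_of_integers (K {})" for p c
    proof -
      obtain m n where "c = of_int m * 1 + of_int n * \<alpha> r"
        using c ext unfolding free_rank_two_def by (auto elim!: Ints_cases)
      moreover have "frobenius_fixed p (\<alpha> r)"
      proof (rule frobenius_fixed_sqrt[OF p])
        show "(\<alpha> r)\<^sup>2 = of_int (-1)" by (simp add: assms(8) power_divide s_r)
        show "\<not> int p dvd - 1" using prime_gt_1_nat[OF p(1)] by simp
      qed
      ultimately show ?thesis
        using p by (simp add: frobenius_fixed_add frobenius_fixed_mult frobenius_fixed_of_int)
    qed
    ultimately show ?case by blast
  next
    case (insert j F)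
    have j: "j \<in> {1..<r}" and F: "F \<subseteq> {1..<r}" using insert.prems by auto
    have qj: "Factorial_Ring.prime \<bar>q j\<bar>" "odd \<bar>q j\<bar>" "[q j = 1] (mod 4)"
      using assms(3)[OF j] by auto
    define p where "p = nat \<bar>q j\<bar>"
    have abs_q: "\<bar>q j\<bar> = int p" by (simp add: p_def)
    have p: "Factorial_Ring.prime p" using qj(1) by (simp add: abs_q)
    have podd: "odd p" using qj(2) by (simp add: abs_q)
    have s_j: "(sqrt_q j)\<^sup>2 = of_int (q j)" using assms(5) j by simp
    have IH1: "int_free_family (insert r F \<rightarrow>\<^sub>E {0, 1}) (\<lambda>s. \<Prod>i\<in>insert r F. w1 i (s i))
        (ring_of_integers (K F))"
      and IH2: "int_free_family (insert r F \<rightarrow>\<^sub>E {0, 1}) (\<lambda>s. \<Prod>i\<in>insert r F. w2 i (s i))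
        (ring_of_integers (K F))"
      and IH3: "\<And>l c. Factorial_Ring.prime l \<Longrightarrow> odd l \<Longrightarrow> (\<And>i. i \<in> F \<Longrightarrow> \<bar>q i\<bar> \<noteq> int l)
        \<Longrightarrow> c \<in> ring_of_integers (K F) \<Longrightarrow> frobenius_fixed l c"
      using insert.IH[OF F] by blast+
    have K: "is_subfield (K F)" unfolding K_def by (rule is_subfield_rat_adjoin)
    have "frobenius_fixed p c" if "c \<in> ring_of_integers (K F)" for c
      using that abs_inj[OF _ j] insert.hyps F abs_q by (intro IH3 p podd) auto
    note step = ring_of_integers_adjoin_sqrt_prime[OF K p abs_q qj(3) s_j this]
    have KF: "K (insert j F) = quadratic_extension (K F) (sqrt_q j)"
      using rat_adjoin_insert[of "sqrt_q j" "sqrt_q ` insert r F"] step(1) is_subfield_of_int[OF K, of "q j"]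
      by (simp add: K_def s_j insert_commute)
    have ext: "free_rank_two (ring_of_integers (K F)) 1 (\<alpha> j) (ring_of_integers (K (insert j F)))"
      using step(2) unfolding KF assms(6)[OF j] .
    have ext': "free_rank_two (ring_of_integers (K F)) (\<alpha> j) (\<alpha>' j) (ring_of_integers (K (insert j F)))"
    proof -
      have "1 - \<alpha> j = \<alpha>' j" by (simp add: assms(6,7)[OF j] field_simps)
      then show ?thesis
        using free_rank_two_complement[OF ext ring_of_integers_closed[OF K]] by simp
    qed
    have A: "finite (insert r F)" "j \<notin> insert r F" "j \<noteq> r" using insert.hyps j by auto
    have "int_free_family (insert r (insert j F) \<rightarrow>\<^sub>E {0, 1}) (\<lambda>s. \<Prod>i\<in>insert r (insert j F). w1 i (s i))
        (ring_of_integers (K (insert j F)))"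
      unfolding insert_commute[of r]
      using ext by (intro int_free_family_insert[OF A(1,2) IH1]) (simp add: w1_def)
    moreover have "int_free_family (insert r (insert j F) \<rightarrow>\<^sub>E {0, 1}) (\<lambda>s. \<Prod>i\<in>insert r (insert j F). w2 i (s i))
        (ring_of_integers (K (insert j F)))"
      unfolding insert_commute[of r]
      using ext' A(3) by (intro int_free_family_insert[OF A(1,2) IH2]) (simp add: w2_def)
    moreover have "frobenius_fixed l c"
      if l: "Factorial_Ring.prime l" "odd l" and ne: "\<forall>i\<in>insert j F. \<bar>q i\<bar> \<noteq> int l"
        and c: "c \<in> ring_of_integers (K (insert j F))" for l c
    proof (rule frobenius_fixed_adjoin_sqrt_prime[OF l _ s_j])
      show "\<not> int l dvd q j"
      proof
        assume "int l dvd q j"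
        then have "l dvd p" using abs_q by (metis dvd_abs_iff int_dvd_int_iff)
        then have "l = p" using l(1) p by (simp add: primes_dvd_imp_eq)
        then show False using ne abs_q by simp
      qed
      show "free_rank_two (ring_of_integers (K F)) 1 ((1 + sqrt_q j) / 2) (ring_of_integers (K (insert j F)))"
        using ext unfolding assms(6)[OF j] .
      have "0 \<in> ring_of_integers (K F)" "1 \<in> ring_of_integers (K F)"
        using is_subfieldD[OF K] by (simp_all add: ring_of_integers_def)
      then have "0 * 1 + 1 * \<alpha> j \<in> ring_of_integers (K (insert j F))"
        using ext unfolding free_rank_two_def by blast
      then show "algebraic_int ((1 + sqrt_q j) / 2)"
        by (simp add: ring_of_integers_def assms(6)[OF j])
      show "frobenius_fixed l d" if "d \<in> ring_of_integers (K F)" for d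
        using ne that by (intro IH3 l) auto
      show "c \<in> ring_of_integers (K (insert j F))" by (rule c)
    qed
    ultimately show ?case by blast
  qed
  have ins: "insert r {1..<r} = {1..r}" using assms(1) by auto
  have fin: "finite ({1..r} \<rightarrow>\<^sub>E {0, 1::nat})" by (intro finite_PiE) auto
  have "(\<Prod>i\<in>{1..r}. w2 i (s i)) = (\<Prod>i\<in>{1..<r}. \<alpha>' i ^ s i * \<alpha> i ^ (1 - s i)) * \<alpha> r ^ s r" for s
  proof -
    have "(\<Prod>i\<in>{1..<r}. w2 i (s i)) = (\<Prod>i\<in>{1..<r}. \<alpha>' i ^ s i * \<alpha> i ^ (1 - s i))"
      by (rule prod.cong) (auto simp: w2_def)
    then show ?thesis unfolding ins[symmetric] by (simp add: w2_def)
  qed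
  then have w2: "(\<lambda>s. \<Prod>i\<in>{1..r}. w2 i (s i))
      = (\<lambda>s. (\<Prod>i\<in>{1..<r}. \<alpha>' i ^ s i * \<alpha> i ^ (1 - s i)) * \<alpha> r ^ s r)" by (rule ext)
  have KE: "K {1..<r} = rat_adjoin (sqrt_q ` {1..r})" unfolding K_def ins ..
  have "finite {1..<r}" "{1..<r} \<subseteq> {1..<r}" by simp_all
  note full = tower[OF this, unfolded ins KE]
  show ?thesis
    using int_basis_family_if_free[OF fin full[THEN conjunct1]]
      int_basis_family_if_free[OF fin full[THEN conjunct2, THEN conjunct1]]
    unfolding w1_def w2 by (rule conjI)
qed

end
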